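(* Let $X$ be a finite set such that $n=|X|\geq 4$ is even. Then the diameter of the commuting graph $\mathcal{G}(\mathcal{I}(X))$ is $4$.
   Context: For a finite set $X$, $\mathcal{I}(X)$ is the symmetric inverse semigroup on $X$: all partial injective transformations of $X$ (injective functions whose domain and image are subsets of $X$) under composition of partial functions. The commuting graph $\mathcal{G}(S)$ of a finite non-commutative semigroup $S$ is the simple graph whose vertices are the elements of $S$ not in the center $Z(S)=\{a\in S: ab=ba\text{ for all }b\in S\}$, two distinct vertices $a,b$ being adjacent iff $ab=ba$. The diameter of a graph is the maximum distance between two of its vertices, where distance is the length (number of edges) of a shortest path, or $\infty$ if no path exists. *)

theory Defs
  imports Main "Graph_Theory.Pair_Digraph" "Graph_Theory.Shortest_Path"
begin

text \<open>
  A semigroup is given by its carrier \<open>S\<close> and its multiplication \<open>m\<close>, which only matters on \<open>S\<close>.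
\<close>

definition finite_noncomm_semigroup :: "'a set \<Rightarrow> ('a \<Rightarrow> 'a \<Rightarrow> 'a) \<Rightarrow> bool" where
  "finite_noncomm_semigroup S m \<longleftrightarrow>
     finite S \<and>
     (\<forall>a\<in>S. \<forall>b\<in>S. m a b \<in> S) \<and>
     (\<forall>a\<in>S. \<forall>b\<in>S. \<forall>c\<in>S. m (m a b) c = m a (m b c)) \<and>
     (\<exists>a\<in>S. \<exists>b\<in>S. m a b \<noteq> m b a)"

definition semigroup_center :: "'a set \<Rightarrow> ('a \<Rightarrow> 'a \<Rightarrow> 'a) \<Rightarrow> 'a set" where
  "semigroup_center S m = {a \<in> S. \<forall>b\<in>S. m a b = m b a}"

text \<open>
  A simple graph is a symmetric loop-free digraph without multiple arcs, that is,
  an instance of the locale \<^locale>\<open>pair_graph\<close>.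
\<close>

definition commuting_graph :: "'a set \<Rightarrow> ('a \<Rightarrow> 'a \<Rightarrow> 'a) \<Rightarrow> 'a pair_pre_digraph" where
  "commuting_graph S m =
     \<lparr> pverts = S - semigroup_center S m,
       parcs = {(a, b). a \<in> S - semigroup_center S m \<and> b \<in> S - semigroup_center S m \<and>
                        a \<noteq> b \<and> m a b = m b a} \<rparr>"

text \<open>
  With all arc weights equal to 1, \<open>\<mu>\<close> is the number of arcs of a shortest walk, and
  \<open>\<infinity>\<close> if there is no walk. \<^const>\<open>wf_digraph.\<mu>\<close> is specified for well-formed digraphs only;
  \<open>pair_graph_commuting_graph\<close> below shows that this covers commuting graphs.
\<close>

definition graph_distance :: "('a, 'b) pre_digraph \<Rightarrow> 'a \<Rightarrow> 'a \<Rightarrow> ereal" where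
  "graph_distance G u v = wf_digraph.\<mu> G (\<lambda>_. 1) u v"

text \<open>For a finite graph with at least one vertex the supremum is a maximum.\<close>

definition graph_diameter :: "('a, 'b) pre_digraph \<Rightarrow> ereal" where
  "graph_diameter G = (SUP u\<in>verts G. SUP v\<in>verts G. graph_distance G u v)"

text \<open>
  Partial transformations are maps, multiplied by \<^const>\<open>map_comp\<close> (right factor first). The
  opposite convention gives the opposite semigroup, which has the same commuting graph.
\<close>

definition sym_inv_semigroup :: "'a set \<Rightarrow> ('a \<rightharpoonup> 'a) set" where
  "sym_inv_semigroup X = {f. dom f \<subseteq> X \<and> ran f \<subseteq> X \<and> inj_on f (dom f)}"

lemma pair_graph_commuting_graph:
  assumes "finite S"
  shows "pair_graph (commuting_graph S m)"
proof
  let ?V = "S - semigroup_center S m"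
  show "finite (parcs (commuting_graph S m))"
    by (rule finite_subset[of _ "?V \<times> ?V"]) (use assms in \<open>auto simp: commuting_graph_def\<close>)
  show "symmetric (with_proj (commuting_graph S m))"
    by (auto simp: symmetric_def arcs_ends_def arc_to_ends_def with_proj_def
        commuting_graph_def sym_def image_iff)
qed (use assms in \<open>auto simp: commuting_graph_def\<close>)

lemma graph_distance_unweighted:
  assumes "wf_digraph G"
  shows "graph_distance G u v = (INF p\<in>{p. pre_digraph.awalk G u p v}. ereal (real (length p)))"
proof -
  interpret wf_digraph G by (fact assms)
  have "awalk_cost (\<lambda>_. 1) p = real (length p)" for p :: "'b list"
    by (induction p) auto
  then show ?thesis
    by (simp add: graph_distance_def \<mu>_def)
qed

lemma finite_noncomm_semigroup_sym_inv_semigroup: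
  assumes "finite X" and "card X \<ge> 2"
  shows "finite_noncomm_semigroup (sym_inv_semigroup X) (\<circ>\<^sub>m)"
  unfolding finite_noncomm_semigroup_def
proof (intro conjI ballI)
  have "sym_inv_semigroup X \<subseteq> (\<Union>D\<in>Pow X. {f. dom f = D \<and> ran f \<subseteq> X})"
    by (auto simp: sym_inv_semigroup_def)
  then show "finite (sym_inv_semigroup X)"
    by (rule finite_subset) (use assms in \<open>auto intro: finite_set_of_finite_maps finite_subset\<close>)
next
  fix f g assume fg: "f \<in> sym_inv_semigroup X" "g \<in> sym_inv_semigroup X"
  have inj: "x = y" if "h \<in> sym_inv_semigroup X" "h x = Some z" "h y = Some z"
    for h x y z using that by (auto simp: sym_inv_semigroup_def inj_on_def dom_def)
  have "inj_on (f \<circ>\<^sub>m g) (dom (f \<circ>\<^sub>m g))"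
  proof (rule inj_onI)
    fix x y assume "x \<in> dom (f \<circ>\<^sub>m g)" "y \<in> dom (f \<circ>\<^sub>m g)" "(f \<circ>\<^sub>m g) x = (f \<circ>\<^sub>m g) y"
    then obtain z a b where "g x = Some a" "f a = Some z" "g y = Some b" "f b = Some z"
      by (auto simp: map_comp_Some_iff)
    then show "x = y" using inj fg by metis
  qed
  moreover have "dom (f \<circ>\<^sub>m g) \<subseteq> dom g" "ran (f \<circ>\<^sub>m g) \<subseteq> ran f"
    by (auto simp: map_comp_Some_iff ran_def)
  ultimately show "f \<circ>\<^sub>m g \<in> sym_inv_semigroup X"
    using fg unfolding sym_inv_semigroup_def by (blast intro: order_trans)
next
  fix f g h :: "'a \<rightharpoonup> 'a"
  show "f \<circ>\<^sub>m g \<circ>\<^sub>m h = f \<circ>\<^sub>m (g \<circ>\<^sub>m h)"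
    by (auto simp: map_comp_def fun_eq_iff split: option.splits)
next
  obtain x y where xy: "x \<in> X" "y \<in> X" "x \<noteq> y"
    using assms by (metis card_le_Suc0_iff_eq not_less_eq_eq numeral_2_eq_2)
  let ?f = "[x \<mapsto> y]" and ?g = "[x \<mapsto> x]"
  have "?f \<in> sym_inv_semigroup X" "?g \<in> sym_inv_semigroup X"
    using xy by (auto simp: sym_inv_semigroup_def)
  moreover have "(?f \<circ>\<^sub>m ?g) x \<noteq> (?g \<circ>\<^sub>m ?f) x"
    using xy by (auto simp: map_comp_def)
  ultimately show "\<exists>f\<in>sym_inv_semigroup X. \<exists>g\<in>sym_inv_semigroup X. f \<circ>\<^sub>m g \<noteq> g \<circ>\<^sub>m f"
    by metis
qed

end

theory Submission
  imports Defs "HOL-Combinatorics.Orbits" "HOL-Combinatorics.Cycles"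
begin

text \<open>
  The centre of the symmetric inverse semigroup consists of the empty map and the identity. Every
  noncentral element commutes with a noncentral element of one of three shapes: a partial identity,
  a single arc \<open>x \<mapsto> y\<close>, or an involution of \<open>X\<close> without fixed points. The third shape is needed
  only for a full cycle, whose power with exponent \<open>card X div 2\<close> is such an involution; this is
  where parity enters. Any two elements of these shapes have a common noncentral commuting element,
  so any two vertices are joined by a walk of length 4. The bound is attained by
  a chain through all points of \<open>X\<close> and its reverse: the noncentral elements commuting with them are
  forward shifts and backward shifts respectively, and a forward shift never commutes with a
  backward shift.
\<close>

section \<open>Distances in commuting graphs\<close>

text \<open>Unlike adjacency, this relation is reflexive on the vertices. A walk can therefore
  pause, and "length at most \<open>k\<close>" becomes membership in the \<open>k\<close>-th
  relational power.\<close>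

definition commuting_rel :: "'a set \<Rightarrow> ('a \<Rightarrow> 'a \<Rightarrow> 'a) \<Rightarrow> 'a rel" where
  "commuting_rel S m =
     {(a, b). a \<in> S - semigroup_center S m \<and> b \<in> S - semigroup_center S m \<and> m a b = m b a}"

lemma commuting_rel_sym: "(a, b) \<in> commuting_rel S m \<Longrightarrow> (b, a) \<in> commuting_rel S m"
  by (auto simp: commuting_rel_def)

text \<open>The missing steps are spent on the loop at \<open>b\<close>.\<close>

lemma relpow_reflexive_mono:
  assumes "(a, b) \<in> R ^^ j" "j \<le> k" "(b, b) \<in> R"
  shows "(a, b) \<in> R ^^ k"
  using assms(2,1)
proof (induction rule: dec_induct)
  case (step i)
  then show ?case using assms(3) by auto
qed

lemma awalk_commuting_graph_imp_relpow:
  assumes "pre_digraph.awalk (with_proj (commuting_graph S m)) a p b"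
  shows "(a, b) \<in> commuting_rel S m ^^ length p"
  using assms
proof (induction p arbitrary: a)
  case Nil
  then show ?case by (simp add: pre_digraph.awalk_def pre_digraph.cas.simps)
next
  case (Cons e p)
  obtain c where e: "e = (a, c)" "(a, c) \<in> commuting_rel S m"
    and "pre_digraph.awalk (with_proj (commuting_graph S m)) c p b"
    using Cons.prems
    by (cases e) (auto simp: commuting_graph_def commuting_rel_def pre_digraph.awalk_def pre_digraph.cas.simps)
  then show ?case using Cons.IH by (metis length_Cons relpow_Suc_I2)
qed

text \<open>Dropping the loops leaves a genuine walk, which may be shorter than \<open>k\<close>.
  That \<open>b\<close> is a vertex matters for \<open>k = 0\<close>, where the relational power is
  the identity on the whole type.\<close>

lemma relpow_imp_awalk_commuting_graph:
  assumes "(a, b) \<in> commuting_rel S m ^^ k" "b \<in> S - semigroup_center S m"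
  shows "\<exists>p. pre_digraph.awalk (with_proj (commuting_graph S m)) a p b \<and> length p \<le> k"
  using assms
proof (induction k arbitrary: a)
  case 0
  then show ?case
    by (intro exI[of _ "[]"])
       (auto simp: pre_digraph.awalk_def pre_digraph.cas.simps commuting_graph_def)
next
  case (Suc k)
  obtain c where c: "(a, c) \<in> commuting_rel S m" "(c, b) \<in> commuting_rel S m ^^ k"
    using Suc.prems(1) by (meson relpow_Suc_D2)
  then obtain p where p: "pre_digraph.awalk (with_proj (commuting_graph S m)) c p b" "length p \<le> k"
    using Suc by blast
  show ?case
  proof (cases "a = c")
    case True
    then show ?thesis using p le_Suc_eq by blast
  next
    case False
    then have "pre_digraph.awalk (with_proj (commuting_graph S m)) a ((a, c) # p) b"
      using p(1) c(1)
      by (auto simp: commuting_graph_def commuting_rel_def pre_digraph.awalk_def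
          pre_digraph.cas.simps)
    then show ?thesis using p(2) by (intro exI[of _ "(a, c) # p"]) simp
  qed
qed

lemma graph_distance_commuting_graph_le:
  assumes "finite S" "b \<in> S - semigroup_center S m" "(a, b) \<in> commuting_rel S m ^^ k"
  shows "graph_distance (with_proj (commuting_graph S m)) a b \<le> ereal (real k)"
proof -
  interpret pair_graph "commuting_graph S m"
    using assms(1) by (rule pair_graph_commuting_graph)
  have wf: "wf_digraph (with_proj (commuting_graph S m))" ..
  obtain p where "pre_digraph.awalk (with_proj (commuting_graph S m)) a p b" "length p \<le> k"
    using relpow_imp_awalk_commuting_graph[OF assms(3,2)] by blast
  then show ?thesis
    unfolding graph_distance_unweighted[OF wf] by (intro INF_lower2) auto
qed

text \<open>A walk of length at most \<open>k\<close> could be padded with loops at \<open>b\<close>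
  to exactly \<open>k\<close> steps.\<close>

lemma graph_distance_commuting_graph_ge:
  assumes "finite S" "b \<in> S - semigroup_center S m" "(a, b) \<notin> commuting_rel S m ^^ k"
  shows "ereal (real (Suc k)) \<le> graph_distance (with_proj (commuting_graph S m)) a b"
proof -
  interpret pair_graph "commuting_graph S m"
    using assms(1) by (rule pair_graph_commuting_graph)
  have wf: "wf_digraph (with_proj (commuting_graph S m))" ..
  have "(b, b) \<in> commuting_rel S m"
    using assms(2) by (simp add: commuting_rel_def)
  then have "Suc k \<le> length p" if "pre_digraph.awalk (with_proj (commuting_graph S m)) a p b" for p
    using awalk_commuting_graph_imp_relpow[OF that] relpow_reflexive_mono[of a b] assms(3)
    by (meson not_less_eq_eq)
  then show ?thesis
    unfolding graph_distance_unweighted[OF wf] by (intro INF_greatest) (auto simp del: of_nat_Suc)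
qed

section \<open>Elements of the symmetric inverse semigroup\<close>

lemma sym_inv_semigroupI:
  assumes "\<And>x y. f x = Some y \<Longrightarrow> x \<in> X \<and> y \<in> X"
    and "\<And>x x' y. f x = Some y \<Longrightarrow> f x' = Some y \<Longrightarrow> x = x'"
  shows "f \<in> sym_inv_semigroup X"
  unfolding sym_inv_semigroup_def using assms
  by (auto simp: ran_def intro!: inj_onI)

lemma sym_inv_semigroup_inj:
  "f \<in> sym_inv_semigroup X \<Longrightarrow> f x = Some y \<Longrightarrow> f x' = Some y \<Longrightarrow> x = x'"
  by (auto simp: sym_inv_semigroup_def dom_def inj_on_def)

lemma sym_inv_semigroup_in:
  "f \<in> sym_inv_semigroup X \<Longrightarrow> f x = Some y \<Longrightarrow> x \<in> X \<and> y \<in> X"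
  by (auto simp: sym_inv_semigroup_def ran_def)

lemma restrict_Some_in: "A \<subseteq> X \<Longrightarrow> Some |` A \<in> sym_inv_semigroup X"
  by (rule sym_inv_semigroupI) (auto simp: restrict_map_def split: if_splits)

lemma arc_map_in: "x \<in> X \<Longrightarrow> y \<in> X \<Longrightarrow> [x \<mapsto> y] \<in> sym_inv_semigroup X"
  by (rule sym_inv_semigroupI) (auto split: if_splits)

lemma permutes_map_in: "s permutes X \<Longrightarrow> (Some \<circ> s) |` X \<in> sym_inv_semigroup X"
  by (rule sym_inv_semigroupI)
     (auto simp: restrict_map_def permutes_in_image split: if_splits dest: permutes_inj injD)

text \<open>Single arcs are enough to test centrality: loops \<open>[x \<mapsto> x]\<close> force a
  central element to be a partial identity, and arcs \<open>[x \<mapsto> y]\<close> force its domain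
  to be empty or all of \<open>X\<close>.\<close>

lemma semigroup_center_sym_inv_semigroup_iff:
  assumes "z \<in> sym_inv_semigroup X"
  shows "z \<in> semigroup_center (sym_inv_semigroup X) (\<circ>\<^sub>m) \<longleftrightarrow> z = Map.empty \<or> z = Some |` X"
proof
  assume "z = Map.empty \<or> z = Some |` X"
  then show "z \<in> semigroup_center (sym_inv_semigroup X) (\<circ>\<^sub>m)"
    using assms unfolding semigroup_center_def
    by (auto simp: map_comp_def fun_eq_iff restrict_map_def split: option.splits
        dest: sym_inv_semigroup_in)
next
  assume "z \<in> semigroup_center (sym_inv_semigroup X) (\<circ>\<^sub>m)"
  then have comm: "z \<circ>\<^sub>m g = g \<circ>\<^sub>m z" if "g \<in> sym_inv_semigroup X" for g
    using that by (auto simp: semigroup_center_def)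
  have diag: "y = x" if "z x = Some y" for x y
  proof -
    have "(z \<circ>\<^sub>m [x \<mapsto> x]) x = ([x \<mapsto> x] \<circ>\<^sub>m z) x"
      using comm[of "[x \<mapsto> x]"] that assms arc_map_in sym_inv_semigroup_in by metis
    then show ?thesis using that by (auto simp: map_comp_def split: if_splits)
  qed
  show "z = Map.empty \<or> z = Some |` X"
  proof (rule disjCI, rule ccontr)
    assume ne: "z \<noteq> Some |` X" "z \<noteq> Map.empty"
    then obtain x where x: "z x = Some x" using diag by (metis not_None_eq)
    obtain y where y: "y \<in> X" "z y = None"
    proof -
      obtain y where "z y \<noteq> (Some |` X) y" using ne(1) by blast
      then have "y \<in> X \<and> z y = None"
        using diag[of y] sym_inv_semigroup_in[OF assms, of y]
        by (cases "z y") (auto simp: restrict_map_def split: if_splits)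
      then show ?thesis using that by blast
    qed
    have "x \<in> X" using x assms sym_inv_semigroup_in by metis
    \<comment> \<open>At \<open>x\<close> the left side is \<open>z y\<close>, which is undefined,
      whereas the right side is \<open>Some y\<close>.\<close>
    then have "(z \<circ>\<^sub>m [x \<mapsto> y]) x = ([x \<mapsto> y] \<circ>\<^sub>m z) x"
      using comm[of "[x \<mapsto> y]"] y(1) arc_map_in by metis
    then show False using x y(2) by (simp add: map_comp_def)
  qed
qed

section \<open>Noncentral elements and simple commutation rules\<close>

abbreviation sis_vertices :: "'a set \<Rightarrow> ('a \<rightharpoonup> 'a) set" where
  "sis_vertices X \<equiv> sym_inv_semigroup X - semigroup_center (sym_inv_semigroup X) (\<circ>\<^sub>m)"

abbreviation sis_commuting_rel :: "'a set \<Rightarrow> ('a \<rightharpoonup> 'a) rel" where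
  "sis_commuting_rel X \<equiv> commuting_rel (sym_inv_semigroup X) (\<circ>\<^sub>m)"

lemma sis_vertices_iff:
  "f \<in> sis_vertices X \<longleftrightarrow> f \<in> sym_inv_semigroup X \<and> f \<noteq> Map.empty \<and> f \<noteq> Some |` X"
  using semigroup_center_sym_inv_semigroup_iff by blast

lemma sis_commuting_relI:
  assumes "f \<in> sis_vertices X" "g \<in> sis_vertices X" "f \<circ>\<^sub>m g = g \<circ>\<^sub>m f"
  shows "(f, g) \<in> sis_commuting_rel X"
  using assms by (simp add: commuting_rel_def)

lemma restrict_Some_vertex:
  assumes "A \<subset> X" "A \<noteq> {}"
  shows "Some |` A \<in> sis_vertices X"
proof -
  have "dom (Some |` A) = A" "dom (Some |` X) = X" by (auto simp: restrict_map_def split: if_splits)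
  then show ?thesis
    using assms restrict_Some_in[of A X] unfolding sis_vertices_iff by (metis dom_empty psubset_eq)
qed

lemma arc_map_vertex:
  assumes "x \<in> X" "y \<in> X" "\<not> X \<subseteq> {x}"
  shows "[x \<mapsto> y] \<in> sis_vertices X"
proof -
  have "dom (Some |` X) = X" by (auto simp: restrict_map_def split: if_splits)
  then have "[x \<mapsto> y] \<noteq> Some |` X"
    using assms(3) by (metis dom_eq_singleton_conv order_refl)
  then show ?thesis using assms arc_map_in[of x X y] unfolding sis_vertices_iff by simp
qed

lemma permutes_map_vertex:
  assumes "s permutes X" "x \<in> X" "s x \<noteq> x"
  shows "(Some \<circ> s) |` X \<in> sis_vertices X"
proof -
  have "((Some \<circ> s) |` X) x \<noteq> (Some |` X) x" "((Some \<circ> s) |` X) x \<noteq> None"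
    using assms by (auto simp: restrict_map_def)
  then show ?thesis using permutes_map_in[OF assms(1)] unfolding sis_vertices_iff by metis
qed

lemma restrict_Some_commute: "Some |` A \<circ>\<^sub>m Some |` B = Some |` B \<circ>\<^sub>m Some |` A"
  by (auto simp: map_comp_def restrict_map_def fun_eq_iff)

text \<open>Both products are the arc itself if \<open>A\<close> contains both ends, and empty if it
  contains neither.\<close>

lemma arc_map_restrict_Some_commute:
  "(x \<in> A \<longleftrightarrow> y \<in> A) \<Longrightarrow> [x \<mapsto> y] \<circ>\<^sub>m Some |` A = Some |` A \<circ>\<^sub>m [x \<mapsto> y]"
  by (auto simp: map_comp_def restrict_map_def fun_eq_iff)

lemma permutes_map_restrict_Some_commute:
  assumes "s permutes X" "A \<subseteq> X" "\<And>x. s x \<in> A \<longleftrightarrow> x \<in> A"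
  shows "(Some \<circ> s) |` X \<circ>\<^sub>m Some |` A = Some |` A \<circ>\<^sub>m (Some \<circ> s) |` X"
  using assms by (auto simp: map_comp_def restrict_map_def fun_eq_iff)

section \<open>Neighbours of a special form\<close>

definition fixfree_involution_on :: "'a set \<Rightarrow> ('a \<Rightarrow> 'a) \<Rightarrow> bool" where
  "fixfree_involution_on X s \<longleftrightarrow> s permutes X \<and> (\<forall>x. s (s x) = x) \<and> (\<forall>x\<in>X. s x \<noteq> x)"

lemma fixfree_involution_onD:
  assumes "fixfree_involution_on X s"
  shows "s permutes X" "s (s z) = z" "z \<in> X \<Longrightarrow> s z \<noteq> z" "s z \<in> X \<longleftrightarrow> z \<in> X"
  using assms permutes_in_image[of s X z] by (simp_all add: fixfree_involution_on_def)

text \<open>Here \<open>s\<close> is one cycle of length \<open>card X\<close>, so the square of the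
  half power is the identity, while the half power itself stops short of the first return to
  \<open>x\<close>.\<close>

lemma fixfree_involution_power_of_cycle:
  assumes "finite X" "even (card X)" "s permutes X" "X = orbit s x"
  shows "fixfree_involution_on X (s ^^ (card X div 2))"
proof -
  define h where "h = card X div 2"
  have "permutation s" using assms(1,3) by (auto simp: permutation_permutes)
  then have self: "x \<in> orbit s x" by (rule permutation_self_in_orbit)
  \<comment> \<open>The iterates of \<open>x\<close> before its first return are distinct and
    exhaust the orbit.\<close>
  have n: "funpow_dist1 s x x = card X"
    using orbit_conv_funpow_dist1[OF self] card_image[OF inj_on_funpow_dist1[OF self]] assms(4)
    by simp
  have "card X > 0" using self assms(1,4) card_gt_0_iff by auto
  then have h: "0 < h" "h < card X" "h + h = card X"
    using assms(2) unfolding h_def by auto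
  have half: "(s ^^ h) x \<noteq> x" using funpow_dist1_least[of h s x x] h n by simp
  have inj: "inj (s ^^ i)" for i
    using assms(3) by (metis permutes_funpow permutes_inj)
  have double: "(s ^^ h) ((s ^^ h) y) = y" for y
  proof (cases "y \<in> X")
    case True
    then obtain i where i: "y = (s ^^ i) x"
      using assms(4) by (auto simp: orbit_altdef)
    have "(s ^^ h) ((s ^^ h) y) = (s ^^ (h + h)) y" by (simp add: funpow_add)
    also have "\<dots> = (s ^^ (h + h + i)) x" using i by (simp add: funpow_add)
    also have "\<dots> = (s ^^ (i + card X)) x" using h by (simp add: add.commute)
    also have "\<dots> = y" using i funpow_dist1_prop[OF self] n by (simp add: funpow_add)
    finally show ?thesis .
  next
    case False
    then show ?thesis using permutes_funpow[OF assms(3)] by (metis permutes_not_in)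
  qed
  have "(s ^^ h) y \<noteq> y" if y: "y \<in> X" for y
  proof
    assume eq: "(s ^^ h) y = y"
    obtain i where i: "y = (s ^^ i) x"
      using assms(4) y by (auto simp: orbit_altdef)
    \<comment> \<open>Powers of \<open>s\<close> commute, so a fixed point at \<open>y\<close> is
      carried back to one at \<open>x\<close>.\<close>
    have "(s ^^ i) ((s ^^ h) x) = (s ^^ i) x"
      using eq i by (metis add.commute comp_apply funpow_add)
    then show False using half inj[of i] by (auto dest: injD)
  qed
  then show ?thesis
    using double permutes_funpow[OF assms(3)] unfolding fixfree_involution_on_def h_def by blast
qed

text \<open>Both products of a non-permutation with the arc from outside its image to outside its domain
  are empty.\<close>

lemma arc_map_neighbour:
  assumes "finite X" "card X \<ge> 2" "a \<in> sis_vertices X" "u \<in> X" "a u = None"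
  obtains x where "x \<in> X" "(a, [x \<mapsto> u]) \<in> sis_commuting_rel X"
proof -
  have a: "a \<in> sym_inv_semigroup X" using assms(3) by blast
  have dom: "dom a \<subset> X" using a assms(4,5) by (auto simp: sym_inv_semigroup_def)
  have "ran a = (the \<circ> a) ` dom a" by (force simp: ran_def dom_def image_iff)
  \<comment> \<open>Pigeonhole: the image is no larger than the domain, which misses
    \<open>u\<close>, so the image misses a point as well.\<close>
  then have "card (ran a) \<le> card (dom a)"
    using assms(1) dom by (metis card_image_le finite_subset psubset_imp_subset)
  also have "\<dots> < card X" using assms(1) dom by (rule psubset_card_mono)
  finally have "\<not> X \<subseteq> ran a"
    using a assms(1) by (metis (mono_tags) card_mono finite_subset mem_Collect_eq not_le
        sym_inv_semigroup_def)
  then obtain x where x: "x \<in> X" "x \<notin> ran a" by blast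
  have "\<not> X \<subseteq> {x}"
    using assms(2) card_mono[of "{x}" X] by auto
  then have "[x \<mapsto> u] \<in> sis_vertices X" using x(1) assms(4) by (intro arc_map_vertex)
  moreover have "a z \<noteq> Some x" for z using x(2) by (auto simp: ran_def)
  then have "a \<circ>\<^sub>m [x \<mapsto> u] = [x \<mapsto> u] \<circ>\<^sub>m a"
    using assms(5) by (auto simp: map_comp_def fun_eq_iff split: option.splits)
  ultimately show ?thesis using that x(1) assms(3) sis_commuting_relI by metis
qed

section \<open>Special neighbours of an arbitrary vertex\<close>

definition special_vertex :: "'a set \<Rightarrow> ('a \<rightharpoonup> 'a) \<Rightarrow> bool" where
  "special_vertex X f \<longleftrightarrow>
     (\<exists>A. A \<subset> X \<and> A \<noteq> {} \<and> f = Some |` A) \<or>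
     (\<exists>x\<in>X. \<exists>y\<in>X. f = [x \<mapsto> y]) \<or>
     (\<exists>s. fixfree_involution_on X s \<and> f = (Some \<circ> s) |` X)"

lemma special_vertexE [consumes 1, case_names A arc inv]:
  assumes "special_vertex X f"
  obtains A where "A \<subset> X" "A \<noteq> {}" "f = Some |` A"
    | x y where "x \<in> X" "y \<in> X" "f = [x \<mapsto> y]"
    | s where "fixfree_involution_on X s" "f = (Some \<circ> s) |` X"
  using assms unfolding special_vertex_def by blast

text \<open>An injective self-map of a finite set is surjective. Outside \<open>X\<close> the
  permutation is completed by the identity, as \<open>permutes\<close> demands.\<close>

lemma sym_inv_semigroup_total_permutes:
  assumes "finite X" "a \<in> sym_inv_semigroup X" "\<And>x. x \<in> X \<Longrightarrow> a x \<noteq> None"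
  obtains s where "s permutes X" "a = (Some \<circ> s) |` X"
proof
  let ?s = "\<lambda>x. if x \<in> X then the (a x) else x"
  have s: "a x = Some (?s x)" if "x \<in> X" for x using assms(3)[OF that] that by auto
  have "inj_on ?s X"
    using s sym_inv_semigroup_inj[OF assms(2)] by (intro inj_onI) metis
  moreover have "?s ` X \<subseteq> X" using s sym_inv_semigroup_in[OF assms(2)] by blast
  ultimately have "bij_betw ?s X X"
    unfolding bij_betw_def using endo_inj_surj[OF assms(1)] by metis
  then show "?s permutes X" using bij_imp_permutes[of ?s X] by presburger
  show "a = (Some \<circ> ?s) |` X"
  proof
    fix x
    show "a x = ((Some \<circ> ?s) |` X) x"
    proof (cases "x \<in> X")
      case True
      then show ?thesis using s[OF True] by (simp add: restrict_map_def)
    next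
      case False
      then show ?thesis
        using sym_inv_semigroup_in[OF assms(2), of x] by (cases "a x") auto
    qed
  qed
qed

text \<open>If \<open>a\<close> is undefined somewhere on \<open>X\<close>, an arc serves. Otherwise
  \<open>a\<close> is a permutation: a full cycle commutes with its half power, and any other
  permutation commutes with the partial identity on one of its orbits.\<close>

lemma ex_special_neighbour:
  assumes "finite X" "card X \<ge> 2" "even (card X)" "a \<in> sis_vertices X"
  obtains f where "special_vertex X f" "(a, f) \<in> sis_commuting_rel X"
proof (cases "\<exists>u\<in>X. a u = None")
  case True
  then show ?thesis
    using arc_map_neighbour[OF assms(1,2,4)] that by (metis special_vertex_def)
next
  case False
  then obtain s where s: "s permutes X" "a = (Some \<circ> s) |` X"
    using assms(1,4) sym_inv_semigroup_total_permutes[of X a] by (metis DiffD1)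
  obtain x where x: "x \<in> X" using assms(2) by fastforce
  show ?thesis
  proof (cases "orbit s x = X")
    case True
    define t where "t = s ^^ (card X div 2)"
    have t: "fixfree_involution_on X t"
      unfolding t_def using assms(1,3) s(1) True by (intro fixfree_involution_power_of_cycle) auto
    then have "(Some \<circ> t) |` X \<in> sis_vertices X"
      using x by (intro permutes_map_vertex[of _ _ x]) (auto simp: fixfree_involution_on_def)
    moreover have "s (t y) = t (s y)" for y by (simp add: t_def funpow_swap1)
    then have "a \<circ>\<^sub>m (Some \<circ> t) |` X = (Some \<circ> t) |` X \<circ>\<^sub>m a"
      using s t permutes_in_image
      by (fastforce simp: map_comp_def restrict_map_def fun_eq_iff fixfree_involution_on_def)
    ultimately have "(a, (Some \<circ> t) |` X) \<in> sis_commuting_rel X"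
      using assms(4) by (intro sis_commuting_relI)
    moreover have "special_vertex X ((Some \<circ> t) |` X)"
      using t unfolding special_vertex_def by metis
    ultimately show ?thesis using that by metis
  next
    case False
    then have A: "orbit s x \<subset> X" "orbit s x \<noteq> {}"
      using permutes_orbit_subset[OF s(1) x] orbit_nonempty[of s x] by blast+
    have cyc: "cyclic_on s (orbit s x)" using cyclic_on_orbit[OF s(1) assms(1)] .
    \<comment> \<open>On a finite set an orbit is closed under preimages as well as images.\<close>
    have "s y \<in> orbit s x \<longleftrightarrow> y \<in> orbit s x" for y
      using cyc cyclic_on_f_in[OF s(1) cyc] cyclic_on_inI by metis
    then have "a \<circ>\<^sub>m Some |` orbit s x = Some |` orbit s x \<circ>\<^sub>m a"
      unfolding s(2) using A(1) by (intro permutes_map_restrict_Some_commute[OF s(1)]) auto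
    then have "(a, Some |` orbit s x) \<in> sis_commuting_rel X"
      using assms(4) restrict_Some_vertex[OF A] by (intro sis_commuting_relI)
    moreover have "special_vertex X (Some |` orbit s x)"
      using A unfolding special_vertex_def by metis
    ultimately show ?thesis using that by metis
  qed
qed

section \<open>Common neighbours\<close>

lemma psubset_of_card_less: "finite X \<Longrightarrow> A \<subseteq> X \<Longrightarrow> card A < card X \<Longrightarrow> A \<subset> X"
  by auto

text \<open>The sets \<open>A\<close>, \<open>{x, y}\<close> and \<open>{x, s x}\<close> serve for
  the three shapes, the last two being proper because \<open>card X \<ge> 4\<close>. As partial
  identities commute with each other, this settles every pair of special vertices that contains
  one.\<close>

lemma special_vertex_partial_identity:
  assumes "finite X" "card X \<ge> 4" "special_vertex X f"
  obtains B where "B \<subset> X" "B \<noteq> {}" "f \<circ>\<^sub>m Some |` B = Some |` B \<circ>\<^sub>m f"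
proof -
  have pair: "{x, y} \<subset> X" if "x \<in> X" "y \<in> X" for x y
    using that assms(1,2) card_insert_le_m1[of 2 "{y}" x]
    by (intro psubset_of_card_less) auto
  from assms(3) show ?thesis
  proof (cases rule: special_vertexE)
    case (A A)
    then show ?thesis using that by blast
  next
    case (arc x y)
    then show ?thesis
      using that[OF pair[of x y]] arc_map_restrict_Some_commute[of x "{x, y}" y] by simp
  next
    case (inv s)
    obtain x where x: "x \<in> X" using assms(2) by fastforce
    then have sx: "s x \<in> X" using inv(1) by (simp add: fixfree_involution_on_def permutes_in_image)
    have "s y \<in> {x, s x} \<longleftrightarrow> y \<in> {x, s x}" for y
      using inv(1) unfolding fixfree_involution_on_def by (metis insert_iff singletonD)
    then show ?thesis
      using that[OF pair[OF x sx]] inv x sx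
        permutes_map_restrict_Some_commute[of s X "{x, s x}"]
      by (auto simp: fixfree_involution_on_def)
  qed
qed

text \<open>If the arcs share no point, \<open>{x, y}\<close> contains one arc and avoids the other.
  If they share a point, together they cover at most three points, so their union is still
  proper.\<close>

lemma arc_maps_common_neighbour:
  assumes "finite X" "card X \<ge> 4" "x \<in> X" "y \<in> X" "x' \<in> X" "y' \<in> X"
  obtains B where "B \<subset> X" "B \<noteq> {}"
    "[x \<mapsto> y] \<circ>\<^sub>m Some |` B = Some |` B \<circ>\<^sub>m [x \<mapsto> y]"
    "[x' \<mapsto> y'] \<circ>\<^sub>m Some |` B = Some |` B \<circ>\<^sub>m [x' \<mapsto> y']"
proof (cases "{x, y} \<inter> {x', y'} = {}")
  case True
  have "{x, y} \<subset> X"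
    using assms card_insert_le_m1[of 2 "{y}" x] by (intro psubset_of_card_less) auto
  then show ?thesis
    using that[of "{x, y}"] True arc_map_restrict_Some_commute[of x "{x, y}" y]
      arc_map_restrict_Some_commute[of x' "{x, y}" y'] by auto
next
  case False
  then have "card {x, y, x', y'} < 4"
    using card_insert_le_m1[of 3 "{x', y'}" x] card_insert_le_m1[of 3 "{x', y'}" y]
    by (auto simp: card_insert_if)
  then have "{x, y, x', y'} \<subset> X"
    using assms by (intro psubset_of_card_less) auto
  then show ?thesis
    using that[of "{x, y, x', y'}"] arc_map_restrict_Some_commute[of x "{x, y, x', y'}" y]
      arc_map_restrict_Some_commute[of x' "{x, y, x', y'}" y'] by auto
qed

text \<open>If the arc stays inside the pair \<open>{x, s x}\<close>, the partial identity on that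
  pair works. Otherwise the arc is made symmetric under \<open>s\<close>.\<close>

lemma arc_map_involution_common_neighbour:
  assumes "finite X" "card X \<ge> 4" "x \<in> X" "y \<in> X" "fixfree_involution_on X s"
  obtains c where "c \<in> sis_vertices X" "[x \<mapsto> y] \<circ>\<^sub>m c = c \<circ>\<^sub>m [x \<mapsto> y]"
    "(Some \<circ> s) |` X \<circ>\<^sub>m c = c \<circ>\<^sub>m (Some \<circ> s) |` X"
proof -
  have s: "s permutes X" "\<And>z. s (s z) = z" "\<And>z. z \<in> X \<Longrightarrow> s z \<noteq> z" "\<And>z. s z \<in> X \<longleftrightarrow> z \<in> X"
    by (fact fixfree_involution_onD[OF assms(5)])+
  have sub: "{x, s x} \<subset> X"
    using assms s(4) card_insert_le_m1[of 2 "{s x}" x] by (intro psubset_of_card_less) auto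
  show ?thesis
  proof (cases "y \<in> {x, s x}")
    case True
    have "s z \<in> {x, s x} \<longleftrightarrow> z \<in> {x, s x}" for z
      using s(2) by (metis insert_iff singletonD)
    then show ?thesis
      using that[of "Some |` {x, s x}"] sub s(1) True restrict_Some_vertex[of "{x, s x}" X]
        arc_map_restrict_Some_commute[of x "{x, s x}" y]
        permutes_map_restrict_Some_commute[of s X "{x, s x}"] by auto
  next
    case False
    \<comment> \<open>The arc together with its image under \<open>s\<close>. Its sources
      \<open>x\<close>, \<open>s x\<close> and targets \<open>y\<close>, \<open>s y\<close> are four
      different points, so both products with \<open>[x \<mapsto> y]\<close> are empty.\<close>
    define c where "c = [x \<mapsto> y, s x \<mapsto> s y]"
    have distinct: "x \<noteq> s x" "y \<noteq> s y" "x \<noteq> y" "y \<noteq> s x" "s x \<noteq> s y" "x \<noteq> s y"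
      using False s assms(3,4) by (auto, metis+)
    have "c \<in> sym_inv_semigroup X"
      using distinct assms(3,4) s(4) unfolding c_def
      by (intro sym_inv_semigroupI) (auto split: if_splits)
    moreover have "dom c \<noteq> dom (Some |` X)"
      using sub by (auto simp: c_def)
    moreover have "c \<noteq> Map.empty" by (simp add: c_def)
    ultimately have "c \<in> sis_vertices X"
      unfolding sis_vertices_iff by blast
    moreover have "[x \<mapsto> y] \<circ>\<^sub>m c = c \<circ>\<^sub>m [x \<mapsto> y]"
      using distinct by (auto simp: c_def map_comp_def fun_eq_iff)
    moreover have "((Some \<circ> s) |` X \<circ>\<^sub>m c) z = (c \<circ>\<^sub>m (Some \<circ> s) |` X) z" for z
    proof (cases "z \<in> {x, s x}")
      case True
      then show ?thesis
        using distinct s assms(3,4) by (auto simp: c_def map_comp_def restrict_map_def)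
    next
      case False
      then have "s z \<notin> {x, s x}" using s(2) by (metis insert_iff singletonD)
      then show ?thesis using False by (auto simp: c_def map_comp_def restrict_map_def)
    qed
    ultimately show ?thesis using that by blast
  qed
qed

text \<open>In the dihedral group generated by two involutions, a rotation equal to a reflection at a
  point makes a conjugate of one of the involutions fix a point.\<close>

lemma rotation_neq_reflection:
  assumes s: "fixfree_involution_on X s" and t: "fixfree_involution_on X t" and "x \<in> X"
  shows "((s \<circ> t) ^^ i) x \<noteq> s (((s \<circ> t) ^^ j) x)"
proof -
  let ?r = "s \<circ> t"
  have inv: "\<And>z. s (s z) = z" "\<And>z. t (t z) = z"
    and fixfree: "\<And>z. z \<in> X \<Longrightarrow> s z \<noteq> z" "\<And>z. z \<in> X \<Longrightarrow> t z \<noteq> z"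
    and closed: "\<And>z. s z \<in> X \<longleftrightarrow> z \<in> X" "\<And>z. t z \<in> X \<longleftrightarrow> z \<in> X"
    using fixfree_involution_onD s t by metis+
  \<comment> \<open>Exponents 0 and 1 would give a fixed point of \<open>s\<close> or of
    \<open>t\<close>. For larger exponents, cancelling one \<open>?r\<close> on the left moves the
    equation to the point \<open>?r x\<close> and lowers the exponent by two.\<close>
  have base: "(?r ^^ i) x \<noteq> s x" if "x \<in> X" for i x
    using that
  proof (induction i arbitrary: x rule: less_induct)
    case (less i)
    consider "i = 0" | "i = 1" | k where "i = Suc (Suc k)"
      by (metis One_nat_def not0_implies_Suc)
    then show ?case
    proof cases
      case 1
      then show ?thesis using fixfree(1)[OF less.prems] by (metis funpow_0)
    next
      case 2
      then show ?thesis using fixfree(2) less.prems inv(1) by (auto dest: arg_cong[of _ _ s])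
    next
      case 3
      have "?r x \<in> X" using less.prems closed by simp
      then have neq: "(?r ^^ k) (?r x) \<noteq> s (?r x)" using less.IH[of k "?r x"] 3 by (simp del: comp_apply)
      have "(?r ^^ i) x = ?r ((?r ^^ k) (?r x))"
        using 3 by (metis funpow.simps(2) comp_apply funpow_swap1)
      moreover have "s x = ?r (s (?r x))" using inv by simp
      ultimately show ?thesis using neq inv by (metis comp_apply)
    qed
  qed
  show ?thesis
  proof (induction j arbitrary: i)
    case 0
    then show ?case using base[OF assms(3)] by (simp del: comp_apply)
  next
    case (Suc j)
    \<comment> \<open>Applying \<open>?r\<close> to both sides trades one rotation on the reflected
      side for one more on the other side.\<close>
    have "?r (s ((?r ^^ Suc j) x)) = s ((?r ^^ j) x)" using inv by simp
    moreover have "?r ((?r ^^ i) x) = (?r ^^ Suc i) x" by simp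
    ultimately show ?case using Suc.IH[of "Suc i"] by metis
  qed
qed

text \<open>Both \<open>s\<close> and \<open>t\<close> map the orbit \<open>A\<close> of
  \<open>s \<circ> t\<close> onto the same set, disjoint from \<open>A\<close>, and both conjugate
  \<open>s \<circ> t\<close> to \<open>t \<circ> s\<close>. Using the first rotation on
  \<open>A\<close> and the second on its mirror image hence gives a map commuting with both.\<close>

lemma involutions_common_neighbour:
  assumes "finite X" "card X \<ge> 4" "fixfree_involution_on X s" "fixfree_involution_on X t"
  obtains c where "c \<in> sis_vertices X"
    "(Some \<circ> s) |` X \<circ>\<^sub>m c = c \<circ>\<^sub>m (Some \<circ> s) |` X"
    "(Some \<circ> t) |` X \<circ>\<^sub>m c = c \<circ>\<^sub>m (Some \<circ> t) |` X"
proof -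
  have perm: "s permutes X" "t permutes X"
    and inv [simp]: "\<And>z. s (s z) = z" "\<And>z. t (t z) = z"
    and closed [simp]: "\<And>z. s z \<in> X \<longleftrightarrow> z \<in> X" "\<And>z. t z \<in> X \<longleftrightarrow> z \<in> X"
    using fixfree_involution_onD assms(3,4) by metis+
  have eqs: "s y = s z \<longleftrightarrow> y = z" "t y = t z \<longleftrightarrow> y = z" for y z
    by (metis inv)+
  obtain x where x: "x \<in> X" using assms(2) by fastforce
  define A where "A = orbit (s \<circ> t) x"
  have rperm: "(s \<circ> t) permutes X" using perm by (simp add: permutes_compose)
  then have AX: "A \<subseteq> X" unfolding A_def using x by (rule permutes_orbit_subset)
  have "permutation (s \<circ> t)" using rperm assms(1) by (auto simp: permutation_permutes)
  then have A_alt: "A = {((s \<circ> t) ^^ n) x | n. True}" and xA: "x \<in> A"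
    unfolding A_def by (rule orbit_altdef_permutation, rule permutation_self_in_orbit)
  have cyc: "cyclic_on (s \<circ> t) A" unfolding A_def using cyclic_on_orbit[OF rperm assms(1)] .
  have rA: "s (t z) \<in> A \<longleftrightarrow> z \<in> A" for z
    using cyclic_on_inI[OF cyc] cyclic_on_f_in[OF rperm cyc] by (metis comp_apply)
  have r'A: "t (s z) \<in> A \<longleftrightarrow> z \<in> A" for z using rA[of "t (s z)"] by simp
  have tA: "t z \<in> A \<longleftrightarrow> s z \<in> A" for z using r'A[of "s z"] by simp
  have disj: "s z \<notin> A" if "z \<in> A" for z
  proof
    assume "s z \<in> A"
    then obtain i j where "s z = ((s \<circ> t) ^^ i) x" "z = ((s \<circ> t) ^^ j) x"
      using \<open>z \<in> A\<close> unfolding A_alt by blast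
    then show False using rotation_neq_reflection[OF assms(3,4) x, of i j] by simp
  qed
  \<comment> \<open>The colour-preserving rotation by two of the alternating cycle through \<open>x\<close>.\<close>
  define c where "c = (\<lambda>z. if z \<in> A then Some (s (t z)) else if s z \<in> A then Some (t (s z)) else None)"
  have cin: "c \<in> sym_inv_semigroup X"
  proof (rule sym_inv_semigroupI)
    fix y z assume "c y = Some z"
    then show "y \<in> X \<and> z \<in> X"
      using AX subsetD[OF AX, of "s y"] by (auto simp: c_def split: if_splits)
  next
    \<comment> \<open>Since \<open>c\<close> respects membership in \<open>A\<close>, injectivity
      can be checked on each branch separately.\<close>
    have c_in_A: "z \<in> A \<longleftrightarrow> y \<in> A" if "c y = Some z" for y z
      using that rA[of y] r'A[of y] by (auto simp: c_def split: if_splits)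
    fix y y' z assume "c y = Some z" "c y' = Some z"
    moreover from this have "y \<in> A \<longleftrightarrow> y' \<in> A" using c_in_A by metis
    ultimately show "y = y'" by (auto simp: c_def eqs split: if_splits)
  qed
  moreover have "c \<noteq> Map.empty"
  proof
    assume c: "c = Map.empty"
    show False using fun_cong[OF c, of x] xA by (simp add: c_def)
  qed
  moreover have "c \<noteq> Some |` X"
  proof
    assume c: "c = Some |` X"
    \<comment> \<open>Were \<open>c\<close> the identity, the orbit would be a single point and
      \<open>X\<close> would have at most the two points \<open>x\<close> and
      \<open>s x\<close>.\<close>
    have "(s \<circ> t) x = x" using fun_cong[OF c, of x] x xA by (simp add: c_def)
    then have "A = {x}" unfolding A_def by (simp only: orbit_eq_singleton_iff)
    moreover have "z \<in> A \<or> s z \<in> A" if "z \<in> X" for z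
      using fun_cong[OF c, of z] that by (auto simp: c_def restrict_map_def split: if_splits)
    ultimately have "X \<subseteq> {x, s x}" by (metis inv(1) insert_iff singletonD subsetI)
    then have "card X \<le> card {x, s x}" by (intro card_mono) auto
    then show False using assms(2) card_insert_le_m1[of 2 "{s x}" x] by simp
  qed
  ultimately have "c \<in> sis_vertices X" unfolding sis_vertices_iff by blast
  moreover have "((Some \<circ> s) |` X \<circ>\<^sub>m c) z = (c \<circ>\<^sub>m (Some \<circ> s) |` X) z" for z
    using disj[of z] AX closed
    by (auto simp: c_def map_comp_def restrict_map_def)
  moreover have "((Some \<circ> t) |` X \<circ>\<^sub>m c) z = (c \<circ>\<^sub>m (Some \<circ> t) |` X) z" for z
    using disj[of z] disj[of "t z"] AX closed tA rA r'A
    by (auto simp: c_def map_comp_def restrict_map_def)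
  ultimately show ?thesis using that by blast
qed

section \<open>Walks of length four between any two vertices\<close>

lemma special_vertices_common_neighbour:
  assumes "finite X" "card X \<ge> 4" "special_vertex X f" "special_vertex X g"
  obtains c where "c \<in> sis_vertices X" "f \<circ>\<^sub>m c = c \<circ>\<^sub>m f" "g \<circ>\<^sub>m c = c \<circ>\<^sub>m g"
proof -
  have pid: "\<exists>c\<in>sis_vertices X. Some |` A \<circ>\<^sub>m c = c \<circ>\<^sub>m Some |` A \<and> h \<circ>\<^sub>m c = c \<circ>\<^sub>m h"
    if "special_vertex X h" for A h
    using special_vertex_partial_identity[OF assms(1,2) that] restrict_Some_vertex
      restrict_Some_commute by metis
  have arc_case: "\<exists>c\<in>sis_vertices X. [x \<mapsto> y] \<circ>\<^sub>m c = c \<circ>\<^sub>m [x \<mapsto> y] \<and> h \<circ>\<^sub>m c = c \<circ>\<^sub>m h"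
    if h: "special_vertex X h" and xy: "x \<in> X" "y \<in> X" for x y h
  proof -
    have arcx: "special_vertex X [x \<mapsto> y]" using xy unfolding special_vertex_def by blast
    from h show ?thesis
    proof (cases rule: special_vertexE)
      case (A A)
      then show ?thesis using pid[OF arcx, of A] by blast
    next
      case (arc x' y')
      then show ?thesis
        using arc_maps_common_neighbour[OF assms(1,2) xy arc(1,2)] restrict_Some_vertex by metis
    next
      case (inv s)
      then show ?thesis using arc_map_involution_common_neighbour[OF assms(1,2) xy inv(1)] by metis
    qed
  qed
  have "\<exists>c\<in>sis_vertices X. f \<circ>\<^sub>m c = c \<circ>\<^sub>m f \<and> g \<circ>\<^sub>m c = c \<circ>\<^sub>m g"
  proof -
    from assms(3) show ?thesis
    proof (cases rule: special_vertexE)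
      case (A A)
      then show ?thesis using pid[OF assms(4), of A] by blast
    next
      case (arc x y)
      then show ?thesis using arc_case[OF assms(4) arc(1,2)] by blast
    next
      case f: (inv s)
      from assms(4) show ?thesis
      proof (cases rule: special_vertexE)
        case (A A)
        then show ?thesis using pid[OF assms(3), of A] by blast
      next
        case (arc x y)
        then show ?thesis using arc_case[OF assms(3) arc(1,2)] by blast
      next
        case (inv t)
        then show ?thesis
          using involutions_common_neighbour[OF assms(1,2) f(1) inv(1)] f(2) by metis
      qed
    qed
  qed
  then show ?thesis using that by blast
qed

text \<open>The walk is \<open>a\<close>, \<open>f\<close>, \<open>c\<close>, \<open>g\<close>,
  \<open>b\<close>, with special vertices \<open>f\<close> and \<open>g\<close> and a common
  neighbour \<open>c\<close> of them; repetitions are harmless because the relation is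
  reflexive.\<close>

lemma sis_commuting_rel_relpow_4:
  assumes "finite X" "card X \<ge> 4" "even (card X)" "a \<in> sis_vertices X" "b \<in> sis_vertices X"
  shows "(a, b) \<in> sis_commuting_rel X ^^ 4"
proof -
  have card2: "card X \<ge> 2" using assms(2) by simp
  obtain f where f: "special_vertex X f" "(a, f) \<in> sis_commuting_rel X"
    using ex_special_neighbour[OF assms(1) card2 assms(3,4)] .
  obtain g where g: "special_vertex X g" "(b, g) \<in> sis_commuting_rel X"
    using ex_special_neighbour[OF assms(1) card2 assms(3,5)] .
  obtain c where "c \<in> sis_vertices X" "f \<circ>\<^sub>m c = c \<circ>\<^sub>m f" "g \<circ>\<^sub>m c = c \<circ>\<^sub>m g"
    using special_vertices_common_neighbour[OF assms(1,2) f(1) g(1)] .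
  then have "(f, c) \<in> sis_commuting_rel X" "(c, g) \<in> sis_commuting_rel X"
    using f g by (auto simp: commuting_rel_def)
  then show ?thesis
    using f(2) commuting_rel_sym[OF g(2)] by (auto simp: numeral_eq_Suc)
qed

section \<open>Two vertices at distance four\<close>

text \<open>The nilpotent shift along an enumeration \<open>h\<close> of \<open>X\<close>:
  \<open>inv_into\<close> recovers the position of a point, and the last point has no image.\<close>

definition chain_map :: "'a set \<Rightarrow> (nat \<Rightarrow> 'a) \<Rightarrow> 'a \<rightharpoonup> 'a" where
  "chain_map X h x = (if x \<in> X \<and> Suc (inv_into {..<card X} h x) < card X
     then Some (h (Suc (inv_into {..<card X} h x))) else None)"

lemma chain_map_apply:
  assumes "bij_betw h {..<card X} X" "k < card X"
  shows "chain_map X h (h k) = (if Suc k < card X then Some (h (Suc k)) else None)"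
  using assms bij_betw_inv_into_left[OF assms(1), of k] bij_betwE[OF assms(1)]
  by (auto simp: chain_map_def)

lemma chain_map_vertex:
  assumes "bij_betw h {..<card X} X" "card X \<ge> 2"
  shows "chain_map X h \<in> sis_vertices X"
proof -
  let ?n = "card X"
  have inj: "h i = h j \<longleftrightarrow> i = j" if "i < ?n" "j < ?n" for i j
    using assms(1) that by (auto simp: bij_betw_def inj_on_def)
  have elim: "\<exists>k. x = h k \<and> y = h (Suc k) \<and> Suc k < ?n" if "chain_map X h x = Some y" for x y
  proof -
    have "x \<in> X" using that by (auto simp: chain_map_def split: if_splits)
    then obtain k where "k < ?n" "x = h k" using assms(1) by (auto simp: bij_betw_def)
    then show ?thesis using that chain_map_apply[OF assms(1)] by (auto split: if_splits)
  qed
  have "chain_map X h \<in> sym_inv_semigroup X"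
  proof (rule sym_inv_semigroupI)
    fix x y assume "chain_map X h x = Some y"
    then show "x \<in> X \<and> y \<in> X" using elim bij_betwE[OF assms(1)] by fastforce
  next
    fix x x' y assume "chain_map X h x = Some y" "chain_map X h x' = Some y"
    then show "x = x'" using elim inj by (metis Suc_inject)
  qed
  moreover have "chain_map X h (h 0) = Some (h 1)" "h 1 \<noteq> h 0" "h 0 \<in> X"
    using chain_map_apply[OF assms(1), of 0] assms(2) inj[of 1 0] bij_betwE[OF assms(1)] by auto
  ultimately show ?thesis unfolding sis_vertices_iff
    by (metis option.distinct(1) option.inject restrict_in)
qed

text \<open>Commuting with the chain makes \<open>c\<close> determined by its value at
  \<open>h 0\<close>. No value there gives the empty map and the value \<open>h 0\<close> gives the
  identity, both central; what remains is a shift by a positive amount.\<close>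

lemma chain_map_centralizer:
  assumes h: "bij_betw h {..<card X} X"
    and c: "c \<in> sis_vertices X" "chain_map X h \<circ>\<^sub>m c = c \<circ>\<^sub>m chain_map X h"
  obtains i where "0 < i" "i < card X"
    "\<And>k. k < card X \<Longrightarrow> c (h k) = (if k + i < card X then Some (h (k + i)) else None)"
proof -
  let ?n = "card X"
  have step: "c (h (Suc k)) = (case c (h k) of None \<Rightarrow> None | Some y \<Rightarrow> chain_map X h y)"
    if "Suc k < ?n" for k
    using fun_cong[OF c(2), of "h k"] chain_map_apply[OF h, of k] that
    by (auto simp: map_comp_def split: option.splits)
  have cX: "c x = None" if "x \<notin> X" for x
    using c(1) that sym_inv_semigroup_in[of c X x] by (cases "c x") auto
  have surj: "\<exists>k<?n. x = h k" if "x \<in> X" for x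
    using h that by (auto simp: bij_betw_def)
  have "c (h 0) \<noteq> None"
  proof
    assume c0: "c (h 0) = None"
    have "c (h k) = None" if "k < ?n" for k
      using that by (induction k) (auto simp: c0 step)
    then have "c = Map.empty" using cX surj by (metis ext)
    then show False using c(1) sis_vertices_iff by blast
  qed
  then obtain i where i: "i < ?n" "c (h 0) = Some (h i)"
    using surj c(1) sym_inv_semigroup_in by (metis DiffD1 not_None_eq)
  have shift: "c (h k) = (if k + i < ?n then Some (h (k + i)) else None)" if "k < ?n" for k
    using that
  proof (induction k)
    case 0
    then show ?case using i by simp
  next
    case (Suc k)
    then show ?case using step[of k] chain_map_apply[OF h, of "k + i"] by auto
  qed
  have "i \<noteq> 0"
  proof
    assume "i = 0"
    then have "c x = (Some |` X) x" for x
      using shift cX surj[of x] by (cases "x \<in> X") (auto simp: restrict_map_def)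
    then show False using c(1) sis_vertices_iff by blast
  qed
  then show ?thesis using that i(1) shift by blast
qed

text \<open>The two inner vertices of such a walk would be a forward shift by \<open>i\<close> and a
  backward shift by \<open>j\<close>, which disagree at an end of the chain.\<close>

lemma chain_map_reverse_not_relpow_3:
  assumes h: "bij_betw h {..<card X} X"
    and h': "bij_betw h' {..<card X} X" "\<And>k. k < card X \<Longrightarrow> h' k = h (card X - Suc k)"
  shows "(chain_map X h, chain_map X h') \<notin> sis_commuting_rel X ^^ 3"
proof
  let ?n = "card X"
  assume "(chain_map X h, chain_map X h') \<in> sis_commuting_rel X ^^ 3"
  then obtain c d where cd: "(chain_map X h, c) \<in> sis_commuting_rel X"
    "(c, d) \<in> sis_commuting_rel X" "(d, chain_map X h') \<in> sis_commuting_rel X"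
    by (auto simp: numeral_eq_Suc)
  obtain i where i: "0 < i" "i < ?n"
    "\<And>k. k < ?n \<Longrightarrow> c (h k) = (if k + i < ?n then Some (h (k + i)) else None)"
    using chain_map_centralizer[OF h, of c] cd(1) by (auto simp: commuting_rel_def)
  obtain j where j: "0 < j" "j < ?n"
    "\<And>k. k < ?n \<Longrightarrow> d (h' k) = (if k + j < ?n then Some (h' (k + j)) else None)"
    using chain_map_centralizer[OF h'(1), of d] cd(3) by (auto simp: commuting_rel_def)
  have d: "d (h m) = (if j \<le> m then Some (h (m - j)) else None)" if "m < ?n" for m
  proof -
    \<comment> \<open>The point \<open>h m\<close> has position \<open>?n - Suc m\<close> in the
      reversed enumeration.\<close>
    have "?n - Suc (?n - Suc m + j) = m - j" if "j \<le> m" using that \<open>m < ?n\<close> by simp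
    then show ?thesis
      using j(3)[of "?n - Suc m"] h'(2)[of "?n - Suc m"] h'(2)[of "?n - Suc m + j"] that by auto
  qed
  have comm: "(c \<circ>\<^sub>m d) x = (d \<circ>\<^sub>m c) x" for x
    using cd(2) by (simp add: commuting_rel_def)
  show False
  proof (cases "i \<le> j")
    case True
    \<comment> \<open>At the last point \<open>c\<close> is undefined, but going back by
      \<open>j\<close> first leaves room to go forward by \<open>i\<close>.\<close>
    have "?n - 1 < ?n" "\<not> ?n - 1 + i < ?n" "?n - 1 - j + i < ?n" "j \<le> ?n - 1"
      using True i j by auto
    then show False
      using comm[of "h (?n - 1)"] d[of "?n - 1"] i(3)[of "?n - 1"] i(3)[of "?n - 1 - j"] j(2)
      by (simp add: map_comp_def)
  next
    case False
    \<comment> \<open>At the first point \<open>d\<close> is undefined, but going forward by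
      \<open>i\<close> first leaves room to go back by \<open>j\<close>.\<close>
    then show False
      using comm[of "h 0"] d[of 0] d[of i] i j by (simp add: map_comp_def)
  qed
qed

lemma ex_not_sis_commuting_rel_relpow_3:
  assumes "finite X" "card X \<ge> 2"
  obtains a b where "a \<in> sis_vertices X" "b \<in> sis_vertices X" "(a, b) \<notin> sis_commuting_rel X ^^ 3"
proof -
  obtain h where h: "bij_betw h {..<card X} X"
    using ex_bij_betw_nat_finite[OF assms(1)] by (auto simp: atLeast0LessThan)
  have "bij_betw (\<lambda>k. card X - Suc k) {..<card X} {..<card X}"
    by (rule bij_betw_byWitness[of _ "\<lambda>k. card X - Suc k"]) auto
  then have "bij_betw (\<lambda>k. h (card X - Suc k)) {..<card X} X"
    using h bij_betw_trans by (fastforce simp: comp_def)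
  then show ?thesis
    using that chain_map_vertex[OF h assms(2)] chain_map_vertex[OF _ assms(2)]
      chain_map_reverse_not_relpow_3[OF h] by blast
qed

theorem theorem6p12:
  fixes X :: "'a set"
  assumes "finite X" and "card X \<ge> 4" and "even (card X)"
  shows "graph_diameter (with_proj (commuting_graph (sym_inv_semigroup X) (\<circ>\<^sub>m))) = 4"
proof -
  let ?S = "sym_inv_semigroup X"
  let ?G = "with_proj (commuting_graph ?S (\<circ>\<^sub>m))"
  have card2: "card X \<ge> 2" using assms(2) by simp
  have fin: "finite ?S"
    using finite_noncomm_semigroup_sym_inv_semigroup[OF assms(1) card2]
    by (simp add: finite_noncomm_semigroup_def)
  have verts: "verts ?G = sis_vertices X" by (simp add: commuting_graph_def)
  have upper: "graph_distance ?G a b \<le> 4" if "a \<in> sis_vertices X" "b \<in> sis_vertices X" for a b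
    using graph_distance_commuting_graph_le[OF fin that(2) sis_commuting_rel_relpow_4[OF assms that]]
    by simp
  obtain a b where ab: "a \<in> sis_vertices X" "b \<in> sis_vertices X"
    "(a, b) \<notin> sis_commuting_rel X ^^ 3"
    using ex_not_sis_commuting_rel_relpow_3[OF assms(1) card2] .
  have "4 \<le> graph_distance ?G a b"
    using graph_distance_commuting_graph_ge[OF fin ab(2,3)] by simp
  then have "4 \<le> graph_diameter ?G"
    unfolding graph_diameter_def verts using ab(1,2) by (meson SUP_upper2)
  moreover have "graph_diameter ?G \<le> 4"
    unfolding graph_diameter_def verts using upper by (intro SUP_least)
  ultimately show ?thesis by (rule antisym[rotated])
qed

end
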